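(* Let $(L,\cdot,[,],\alpha,\beta)$ be a regular transposed BiHom-Poisson algebra over $K$ and let $D$ be a derivation of $(L,\cdot,\alpha,\beta)$ and $(L,[,],\alpha,\beta)$. Define a ternary operation on $L$ by $$[x,y,z]=D(x)\cdot[\beta^{-1}(y),\beta^{-1}(z)]+D(y)\cdot[\alpha^{-1}(z),\alpha\beta^{-2}(x)]+D\alpha^{-1}\beta(z)\cdot[\beta^{-1}(x),\alpha\beta^{-2}(y)].$$ Then $(L,[\ ,\ ,\ ],\alpha,\beta)$ is a 3-BiHom-Lie algebra.
   Context: $K$ is a field of characteristic $0$; all vector spaces and linear maps are over $K$. A BiHom-commutative algebra $(L,\cdot,\alpha,\beta)$ is a vector space $L$ with a bilinear product $\cdot$ and linear maps $\alpha,\beta:L\to L$ such that for all $x,y,z\in L$: $\alpha\circ\beta=\beta\circ\alpha$, $\alpha(x\cdot y)=\alpha(x)\cdot\alpha(y)$, $\beta(x\cdot y)=\beta(x)\cdot\beta(y)$, $\alpha(x)\cdot(y\cdot z)=(x\cdot y)\cdot\beta(z)$, and $\beta(x)\cdot\alpha(y)=\beta(y)\cdot\alpha(x)$. A BiHom-Lie algebra $(L,[,],\alpha,\beta)$ is a vector space $L$ with a bilinear bracket and commuting linear maps $\alpha,\beta:L\to L$ such that for all $x,y,z\in L$: $\alpha([x,y])=[\alpha(x),\alpha(y)]$, $\beta([x,y])=[\beta(x),\beta(y)]$, $[\beta(x),\alpha(y)]=-[\beta(y),\alpha(x)]$, and $[[\beta(x),\alpha(y)],\alpha^2(z)]+[[\beta(y),\alpha(z)],\alpha^2(x)]+[[\beta(z),\alpha(x)],\alpha^2(y)]=0$.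 A transposed BiHom-Poisson algebra is a 5-tuple $(L,\cdot,[,],\alpha,\beta)$ such that $(L,\cdot,\alpha,\beta)$ is a BiHom-commutative algebra, $(L,[,],\alpha,\beta)$ is a BiHom-Lie algebra, and for all $x,y,z\in L$: $2\alpha\beta(x)\cdot[y,z]=[\beta(x)\cdot y,\beta(z)]+[\beta(y),\alpha(x)\cdot z]$. It is regular if $\alpha,\beta$ are invertible. $D:L\to L$ is a derivation of $(L,\cdot,\alpha,\beta)$ and of $(L,[,],\alpha,\beta)$ if it is linear with $D(x\cdot y)=D(x)\cdot y+x\cdot D(y)$ and $D([x,y])=[D(x),y]+[x,D(y)]$ for all $x,y\in L$. A 3-BiHom-Lie algebra $(L,[\ ,\ ,\ ],\alpha,\beta)$ is a vector space $L$ with commuting linear maps $\alpha,\beta:L\to L$ and a trilinear map $[\ ,\ ,\ ]:L\times L\times L\to L$ such that for all $x,y,z,u,v\in L$: (i) $\alpha([x,y,z])=[\alpha(x),\alpha(y),\alpha(z)]$ and $\beta([x,y,z])=[\beta(x),\beta(y),\beta(z)]$; (ii) $[\beta(x),\beta(y),\alpha(z)]=-[\beta(y),\beta(x),\alpha(z)]=-[\beta(x),\beta(z),\alpha(y)]$; (iii) $[\beta^2(u),\beta^2(v),[\beta(x),\beta(y),\alpha(z)]]=[\beta^2(y),\beta^2(z),[\beta(u),\beta(v),\alpha(x)]]-[\beta^2(x),\beta^2(z),[\beta(u),\beta(v),\alpha(y)]]+[\beta^2(x),\beta^2(y),[\beta(u),\beta(v),\alpha(z)]]$. *)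

theory Defs
  imports Complex_Main
begin

text \<open>The underlying vector space is a whole type \<open>'a\<close> with an arbitrary scalar multiplication
  \<open>scale\<close>; \<open>Vector_Spaces.linear scale scale f\<close> contains \<open>vector_space scale\<close>.\<close>

definition bilinear_op ::
    "('k::field \<Rightarrow> 'a::ab_group_add \<Rightarrow> 'a) \<Rightarrow> ('a \<Rightarrow> 'a \<Rightarrow> 'a) \<Rightarrow> bool" where
  "bilinear_op scale m \<longleftrightarrow>
     (\<forall>y. Vector_Spaces.linear scale scale (\<lambda>x. m x y)) \<and>
     (\<forall>x. Vector_Spaces.linear scale scale (\<lambda>y. m x y))"

definition trilinear_op ::
    "('k::field \<Rightarrow> 'a::ab_group_add \<Rightarrow> 'a) \<Rightarrow> ('a \<Rightarrow> 'a \<Rightarrow> 'a \<Rightarrow> 'a) \<Rightarrow> bool" where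
  "trilinear_op scale t \<longleftrightarrow>
     (\<forall>y z. Vector_Spaces.linear scale scale (\<lambda>x. t x y z)) \<and>
     (\<forall>x z. Vector_Spaces.linear scale scale (\<lambda>y. t x y z)) \<and>
     (\<forall>x y. Vector_Spaces.linear scale scale (\<lambda>z. t x y z))"

locale bihom_vector_space = vector_space scale
  for scale :: "'k::field_char_0 \<Rightarrow> 'a::ab_group_add \<Rightarrow> 'a" +
  fixes \<alpha> \<beta> :: "'a \<Rightarrow> 'a"
  assumes linear_alpha: "Vector_Spaces.linear scale scale \<alpha>"
    and linear_beta: "Vector_Spaces.linear scale scale \<beta>"
    and alpha_beta_commute: "\<alpha> \<circ> \<beta> = \<beta> \<circ> \<alpha>"

locale bihom_commutative_algebra = bihom_vector_space scale \<alpha> \<beta>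
  for scale :: "'k::field_char_0 \<Rightarrow> 'a::ab_group_add \<Rightarrow> 'a"
    and mult :: "'a \<Rightarrow> 'a \<Rightarrow> 'a" (infixl "\<cdot>" 70)
    and \<alpha> \<beta> :: "'a \<Rightarrow> 'a" +
  assumes bilinear_mult: "bilinear_op scale (\<cdot>)"
    and alpha_mult: "\<alpha> (x \<cdot> y) = \<alpha> x \<cdot> \<alpha> y"
    and beta_mult: "\<beta> (x \<cdot> y) = \<beta> x \<cdot> \<beta> y"
    and bihom_assoc: "\<alpha> x \<cdot> (y \<cdot> z) = (x \<cdot> y) \<cdot> \<beta> z"
    and bihom_commute: "\<beta> x \<cdot> \<alpha> y = \<beta> y \<cdot> \<alpha> x"

locale bihom_lie_algebra = bihom_vector_space scale \<alpha> \<beta>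
  for scale :: "'k::field_char_0 \<Rightarrow> 'a::ab_group_add \<Rightarrow> 'a"
    and br :: "'a \<Rightarrow> 'a \<Rightarrow> 'a"
    and \<alpha> \<beta> :: "'a \<Rightarrow> 'a" +
  assumes bilinear_br: "bilinear_op scale br"
    and alpha_br: "\<alpha> (br x y) = br (\<alpha> x) (\<alpha> y)"
    and beta_br: "\<beta> (br x y) = br (\<beta> x) (\<beta> y)"
    and bihom_skew: "br (\<beta> x) (\<alpha> y) = - br (\<beta> y) (\<alpha> x)"
    and bihom_jacobi:
      "br (br (\<beta> x) (\<alpha> y)) (\<alpha> (\<alpha> z)) + br (br (\<beta> y) (\<alpha> z)) (\<alpha> (\<alpha> x))
        + br (br (\<beta> z) (\<alpha> x)) (\<alpha> (\<alpha> y)) = 0"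

locale transposed_bihom_poisson_algebra =
  bihom_commutative_algebra scale mult \<alpha> \<beta> + bihom_lie_algebra scale br \<alpha> \<beta>
  for scale :: "'k::field_char_0 \<Rightarrow> 'a::ab_group_add \<Rightarrow> 'a"
    and mult :: "'a \<Rightarrow> 'a \<Rightarrow> 'a" (infixl "\<cdot>" 70)
    and br :: "'a \<Rightarrow> 'a \<Rightarrow> 'a"
    and \<alpha> \<beta> :: "'a \<Rightarrow> 'a" +
  assumes transposed_leibniz:
    "scale 2 (\<alpha> (\<beta> x) \<cdot> br y z) = br (\<beta> x \<cdot> y) (\<beta> z) + br (\<beta> y) (\<alpha> x \<cdot> z)"

locale regular_transposed_bihom_poisson_algebra =
  transposed_bihom_poisson_algebra scale mult br \<alpha> \<beta>
  for scale :: "'k::field_char_0 \<Rightarrow> 'a::ab_group_add \<Rightarrow> 'a"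
    and mult :: "'a \<Rightarrow> 'a \<Rightarrow> 'a"
    and br :: "'a \<Rightarrow> 'a \<Rightarrow> 'a"
    and \<alpha> \<beta> :: "'a \<Rightarrow> 'a" +
  assumes bij_alpha: "bij \<alpha>" and bij_beta: "bij \<beta>"

text \<open>A derivation of one bilinear operation; it is not required to commute with
  \<open>\<alpha>\<close> or \<open>\<beta>\<close>.\<close>

definition derivation_of ::
    "('k::field \<Rightarrow> 'a::ab_group_add \<Rightarrow> 'a) \<Rightarrow> ('a \<Rightarrow> 'a \<Rightarrow> 'a) \<Rightarrow> ('a \<Rightarrow> 'a) \<Rightarrow> bool" where
  "derivation_of scale m D \<longleftrightarrow>
     Vector_Spaces.linear scale scale D \<and> (\<forall>x y. D (m x y) = m (D x) y + m x (D y))"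

locale three_bihom_lie_algebra = bihom_vector_space scale \<alpha> \<beta>
  for scale :: "'k::field_char_0 \<Rightarrow> 'a::ab_group_add \<Rightarrow> 'a"
    and tri :: "'a \<Rightarrow> 'a \<Rightarrow> 'a \<Rightarrow> 'a"
    and \<alpha> \<beta> :: "'a \<Rightarrow> 'a" +
  assumes trilinear_tri: "trilinear_op scale tri"
    and alpha_tri: "\<alpha> (tri x y z) = tri (\<alpha> x) (\<alpha> y) (\<alpha> z)"
    and beta_tri: "\<beta> (tri x y z) = tri (\<beta> x) (\<beta> y) (\<beta> z)"
    and tri_skew12: "tri (\<beta> x) (\<beta> y) (\<alpha> z) = - tri (\<beta> y) (\<beta> x) (\<alpha> z)"
    and tri_skew23: "tri (\<beta> x) (\<beta> y) (\<alpha> z) = - tri (\<beta> x) (\<beta> z) (\<alpha> y)"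
    and tri_jacobi:
      "tri (\<beta> (\<beta> u)) (\<beta> (\<beta> v)) (tri (\<beta> x) (\<beta> y) (\<alpha> z)) =
         tri (\<beta> (\<beta> y)) (\<beta> (\<beta> z)) (tri (\<beta> u) (\<beta> v) (\<alpha> x))
         - tri (\<beta> (\<beta> x)) (\<beta> (\<beta> z)) (tri (\<beta> u) (\<beta> v) (\<alpha> y))
         + tri (\<beta> (\<beta> x)) (\<beta> (\<beta> y)) (tri (\<beta> u) (\<beta> v) (\<alpha> z))"

end

theory Submission
  imports Defs
begin

text \<open>The twist can be removed. Put \<open>x * y = \<alpha>\<^sup>-\<^sup>1 x \<cdot> \<beta>\<^sup>-\<^sup>1 y\<close> and \<open>{x, y} = [\<alpha>\<^sup>-\<^sup>1 x, \<beta>\<^sup>-\<^sup>1 y]\<close>. Then \<open>*\<close> is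
  commutative and associative, \<open>{,}\<close> is a Lie bracket, \<open>2 x * {y, z} = {x * y, z} + {y, x * z}\<close>
  (a transposed Poisson algebra), and \<open>\<alpha>\<close>, \<open>\<beta>\<close> are commuting automorphisms of it. The ternary
  operation becomes \<open>[x, y, z] = T (\<alpha> x) (\<alpha> y) (\<beta> z)\<close>, where
  \<open>T x y z = D\<^sub>\<alpha> x * {y, z} + D\<^sub>\<alpha> y * {z, x} + D\<^sub>\<alpha> z * {x, y}\<close> and \<open>D\<^sub>\<phi> = \<phi> D \<phi>\<^sup>-\<^sup>1\<close>. What has to be shown is
  that the alternating operation \<open>T\<close> is preserved by \<open>\<alpha>\<close> and \<open>\<beta>\<close> and satisfies the fundamental
  identity of 3-Lie algebras.

  If \<open>D\<close> commuted with \<open>\<alpha>\<close> and \<open>\<beta>\<close>, it would be a derivation of both \<open>*\<close> and \<open>{,}\<close>. In general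
  one only has \<open>D (x * y) = D\<^sub>\<alpha> x * y + x * D\<^sub>\<beta> y\<close>, and likewise for the bracket. Let \<open>M\<^sub>0 = D\<close> and
  let \<open>M\<^sub>k\<^sub>+\<^sub>1\<close> be the mean of the conjugates of \<open>M\<^sub>k\<close> by \<open>\<alpha>\<close> and \<open>\<beta>\<close>. Then \<open>M\<^sub>k\<close> obeys
  the Leibniz rule with \<open>M\<^sub>k\<^sub>+\<^sub>1\<close> on the right-hand side (\<open>twisted_derivation\<close>), and three observations
  replace commutation.

  \<^item> For \<open>k \<ge> 1\<close> every \<open>M\<^sub>k\<close> defines the same \<open>T\<close>: apply \<open>M\<^sub>k\<^sub>-\<^sub>1\<close> to the identity
    \<open>x * {y, z} + y * {z, x} + z * {x, y} = 0\<close> (\<open>tri_twisted_derivation\<close>). So do \<open>D\<^sub>\<alpha>\<close> and \<open>D\<^sub>\<beta>\<close>,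
    because their difference \<open>E\<close> satisfies \<open>E x * y = x * E y\<close> (\<open>tri_eq_0_if_symmetric\<close>).
    Since conjugating \<open>D\<close> does not change \<open>T\<close>, both automorphisms preserve \<open>T\<close>.

  \<^item> Comparing the two ways to evaluate \<open>M\<^sub>k\<close> on \<open>x * y * z\<close> shows that \<open>N = M\<^sub>k\<^sub>+\<^sub>1 - M\<^sub>k\<^sub>+\<^sub>2\<close> can be
    moved across triple products, \<open>N x * y * z = x * y * N z\<close> (\<open>twisted_derivation_shift\<close>).

  \<^item> Consequently \<open>P = M\<^sub>2\<close> behaves like a derivation in \<open>P (h * {y, z}) * a\<close>, except that the term
    in which it hits \<open>h\<close> is \<open>S h * {y, z} * a\<close> for another operator \<open>S\<close>. In the fundamental identity the
    \<open>S\<close>-terms cancel for any \<open>S\<close>, by the Pluecker relation \<open>pluecker\<close>, and the remaining terms balance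
    for each pair of arguments that carry a \<open>P\<close> (\<open>tri_fundamental_identity\<close>).\<close>

section \<open>Identities in transposed Poisson rings\<close>

text \<open>Scalars enter the argument only through division by two, so unique 2-divisibility of the
  additive group takes the place of a ground field.\<close>

locale transposed_poisson_ring =
  fixes mult :: "'a::ab_group_add \<Rightarrow> 'a \<Rightarrow> 'a" (infixl "\<otimes>" 70)
    and br :: "'a \<Rightarrow> 'a \<Rightarrow> 'a" ("\<lbrace>_,_\<rbrace>")
  assumes unique_half: "\<exists>!b. b + b = (a::'a)"
    and mult_add_left: "(x + y) \<otimes> z = x \<otimes> z + y \<otimes> z"
    and mult_commute: "x \<otimes> y = y \<otimes> x"
    and mult_assoc: "(x \<otimes> y) \<otimes> z = x \<otimes> (y \<otimes> z)"
    and br_add_left: "\<lbrace>x + y, z\<rbrace> = \<lbrace>x, z\<rbrace> + \<lbrace>y, z\<rbrace>"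
    and br_skew: "\<lbrace>x, y\<rbrace> = - \<lbrace>y, x\<rbrace>"
    and jacobi: "\<lbrace>\<lbrace>x, y\<rbrace>, z\<rbrace> + \<lbrace>\<lbrace>y, z\<rbrace>, x\<rbrace> + \<lbrace>\<lbrace>z, x\<rbrace>, y\<rbrace> = 0"
    and leibniz: "x \<otimes> \<lbrace>y, z\<rbrace> + x \<otimes> \<lbrace>y, z\<rbrace> = \<lbrace>x \<otimes> y, z\<rbrace> + \<lbrace>y, x \<otimes> z\<rbrace>"
begin

lemma double_cancel: "a + a = b + b \<Longrightarrow> a = (b::'a)"
  using unique_half[of "b + b"] by blast

lemma double_eq_0: "a + a = 0 \<Longrightarrow> a = (0::'a)"
  using double_cancel[of a 0] by simp

lemma mult_add_right: "x \<otimes> (y + z) = x \<otimes> y + x \<otimes> z"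
  by (metis mult_add_left mult_commute)

lemma br_add_right: "\<lbrace>x, y + z\<rbrace> = \<lbrace>x, y\<rbrace> + \<lbrace>x, z\<rbrace>"
  by (metis add.commute br_add_left br_skew minus_add)

lemma mult_0_left [simp]: "0 \<otimes> x = 0" and mult_0_right [simp]: "x \<otimes> 0 = 0"
  using mult_add_left[of 0 0 x] mult_add_right[of x 0 0] by simp_all

lemma br_0_left [simp]: "\<lbrace>0, x\<rbrace> = 0"
  using br_add_left[of 0 0 x] by simp

lemma mult_minus_left: "(- x) \<otimes> y = - (x \<otimes> y)"
  using mult_add_left[of x "- x" y] by (simp add: eq_neg_iff_add_eq_0 add.commute)

lemma mult_minus_right: "x \<otimes> (- y) = - (x \<otimes> y)"
  by (metis mult_minus_left mult_commute)

lemma br_minus_left: "\<lbrace>- x, y\<rbrace> = - \<lbrace>x, y\<rbrace>"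
  using br_add_left[of x "- x" y] by (simp add: eq_neg_iff_add_eq_0 add.commute)

lemma br_minus_right: "\<lbrace>x, - y\<rbrace> = - \<lbrace>x, y\<rbrace>"
  by (metis br_minus_left br_skew)

lemma mult_diff_left: "(x - y) \<otimes> z = x \<otimes> z - y \<otimes> z"
  using mult_add_left[of x "- y" z] by (simp add: mult_minus_left)

lemma mult_diff_right: "x \<otimes> (y - z) = x \<otimes> y - x \<otimes> z"
  using mult_add_right[of x y "- z"] by (simp add: mult_minus_right)

lemma br_diff_left: "\<lbrace>x - y, z\<rbrace> = \<lbrace>x, z\<rbrace> - \<lbrace>y, z\<rbrace>"
  using br_add_left[of x "- y" z] by (simp add: br_minus_left)

lemma br_diff_right: "\<lbrace>x, y - z\<rbrace> = \<lbrace>x, y\<rbrace> - \<lbrace>x, z\<rbrace>"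
  using br_add_right[of x y "- z"] by (simp add: br_minus_right)

lemmas biadditive =
  mult_add_left mult_add_right mult_minus_left mult_minus_right mult_diff_left mult_diff_right
  br_add_left br_add_right br_minus_left br_minus_right br_diff_left br_diff_right

lemma mult_left_commute: "x \<otimes> (y \<otimes> z) = y \<otimes> (x \<otimes> z)"
  by (metis mult_assoc mult_commute)

lemmas mult_ac = mult_assoc mult_commute mult_left_commute

lemma summand_eq: "a + b + c = 0 \<Longrightarrow> a = - b - (c::'a)"
  by (metis add_diff_cancel_right' diff_0 diff_diff_add diff_minus_eq_add minus_diff_commute add.commute)

lemma leibniz_skew: "x \<otimes> \<lbrace>y, z\<rbrace> + x \<otimes> \<lbrace>y, z\<rbrace> = \<lbrace>x \<otimes> y, z\<rbrace> - \<lbrace>x \<otimes> z, y\<rbrace>"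
  using leibniz[of x y z] br_skew[of y "x \<otimes> z"] by simp

lemma cyclic_mult_br: "x \<otimes> \<lbrace>y, z\<rbrace> + y \<otimes> \<lbrace>z, x\<rbrace> + z \<otimes> \<lbrace>x, y\<rbrace> = 0" (is "?S = 0")
proof (rule double_eq_0)
  have "?S + ?S = (x \<otimes> \<lbrace>y, z\<rbrace> + x \<otimes> \<lbrace>y, z\<rbrace>) + (y \<otimes> \<lbrace>z, x\<rbrace> + y \<otimes> \<lbrace>z, x\<rbrace>)
      + (z \<otimes> \<lbrace>x, y\<rbrace> + z \<otimes> \<lbrace>x, y\<rbrace>)"
    by (simp only: ac_simps)
  also have "\<dots> = 0"
    unfolding leibniz_skew by (simp add: mult_commute)
  finally show "?S + ?S = 0" .
qed

text \<open>Let \<open>S\<close> be the left-hand side and \<open>R\<close> the sum with \<open>h\<close> moved to the third argument.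
  Multiplying the Jacobi identity by \<open>h\<close> gives \<open>S + R = 0\<close>; expanding \<open>2 h \<otimes> \<lbrace>x, y\<rbrace>\<close> inside \<open>2 S\<close> and
  using three further instances of the Jacobi identity gives \<open>2 S + R = 0\<close>.\<close>

lemma cyclic_br_mult_br:
  "\<lbrace>h \<otimes> \<lbrace>x, y\<rbrace>, z\<rbrace> + \<lbrace>h \<otimes> \<lbrace>y, z\<rbrace>, x\<rbrace> + \<lbrace>h \<otimes> \<lbrace>z, x\<rbrace>, y\<rbrace> = 0" (is "?S = 0")
proof -
  let ?R = "\<lbrace>\<lbrace>x, y\<rbrace>, h \<otimes> z\<rbrace> + \<lbrace>\<lbrace>y, z\<rbrace>, h \<otimes> x\<rbrace> + \<lbrace>\<lbrace>z, x\<rbrace>, h \<otimes> y\<rbrace>"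
  let ?J = "\<lbrace>\<lbrace>x, y\<rbrace>, z\<rbrace> + \<lbrace>\<lbrace>y, z\<rbrace>, x\<rbrace> + \<lbrace>\<lbrace>z, x\<rbrace>, y\<rbrace>"
  have "?S + ?R = (\<lbrace>h \<otimes> \<lbrace>x, y\<rbrace>, z\<rbrace> + \<lbrace>\<lbrace>x, y\<rbrace>, h \<otimes> z\<rbrace>)
      + (\<lbrace>h \<otimes> \<lbrace>y, z\<rbrace>, x\<rbrace> + \<lbrace>\<lbrace>y, z\<rbrace>, h \<otimes> x\<rbrace>) + (\<lbrace>h \<otimes> \<lbrace>z, x\<rbrace>, y\<rbrace> + \<lbrace>\<lbrace>z, x\<rbrace>, h \<otimes> y\<rbrace>)"
    by (simp only: ac_simps)
  also have "\<dots> = h \<otimes> ?J + h \<otimes> ?J"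
    unfolding leibniz[symmetric] mult_add_right by (simp only: ac_simps)
  finally have 1: "?S + ?R = 0" by (simp add: jacobi)
  have double: "\<lbrace>h \<otimes> \<lbrace>u, v\<rbrace>, w\<rbrace> + \<lbrace>h \<otimes> \<lbrace>u, v\<rbrace>, w\<rbrace> = \<lbrace>\<lbrace>h \<otimes> u, v\<rbrace>, w\<rbrace> + \<lbrace>\<lbrace>u, h \<otimes> v\<rbrace>, w\<rbrace>"
    for u v w
    by (metis br_add_left leibniz)
  have "?S + ?S + ?R = (\<lbrace>h \<otimes> \<lbrace>x, y\<rbrace>, z\<rbrace> + \<lbrace>h \<otimes> \<lbrace>x, y\<rbrace>, z\<rbrace>)
      + (\<lbrace>h \<otimes> \<lbrace>y, z\<rbrace>, x\<rbrace> + \<lbrace>h \<otimes> \<lbrace>y, z\<rbrace>, x\<rbrace>) + (\<lbrace>h \<otimes> \<lbrace>z, x\<rbrace>, y\<rbrace> + \<lbrace>h \<otimes> \<lbrace>z, x\<rbrace>, y\<rbrace>) + ?R"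
    by (simp only: ac_simps)
  also have "\<dots>
      = (\<lbrace>\<lbrace>h \<otimes> x, y\<rbrace>, z\<rbrace> + \<lbrace>\<lbrace>y, z\<rbrace>, h \<otimes> x\<rbrace> + \<lbrace>\<lbrace>z, h \<otimes> x\<rbrace>, y\<rbrace>)
      + (\<lbrace>\<lbrace>h \<otimes> y, z\<rbrace>, x\<rbrace> + \<lbrace>\<lbrace>z, x\<rbrace>, h \<otimes> y\<rbrace> + \<lbrace>\<lbrace>x, h \<otimes> y\<rbrace>, z\<rbrace>)
      + (\<lbrace>\<lbrace>h \<otimes> z, x\<rbrace>, y\<rbrace> + \<lbrace>\<lbrace>x, y\<rbrace>, h \<otimes> z\<rbrace> + \<lbrace>\<lbrace>y, h \<otimes> z\<rbrace>, x\<rbrace>)"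
    unfolding double by (simp only: ac_simps)
  also have "\<dots> = 0" by (simp only: jacobi) simp
  finally show ?thesis using 1 by (simp only: add.assoc add_0_right)
qed

text \<open>Double the left-hand side and absorb the first factors into the second brackets by the
  transposed Leibniz rule. The terms with a given outer \<open>z\<close> collect to \<open>- \<lbrace>h \<otimes> \<lbrace>x, y\<rbrace>, z\<rbrace>\<close> by
  \<open>cyclic_mult_br\<close>, and the cyclic sum of these vanishes by \<open>cyclic_br_mult_br\<close>. The relation has the form
  of the Pluecker relation between the coordinates of a decomposable bivector.\<close>

lemma pluecker: "\<lbrace>h, x\<rbrace> \<otimes> \<lbrace>y, z\<rbrace> + \<lbrace>h, y\<rbrace> \<otimes> \<lbrace>z, x\<rbrace> + \<lbrace>h, z\<rbrace> \<otimes> \<lbrace>x, y\<rbrace> = 0" (is "?P = 0")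
proof (rule double_eq_0)
  have collect: "\<lbrace>\<lbrace>h, u\<rbrace> \<otimes> v, w\<rbrace> - \<lbrace>\<lbrace>h, v\<rbrace> \<otimes> u, w\<rbrace> = - \<lbrace>h \<otimes> \<lbrace>u, v\<rbrace>, w\<rbrace>" for u v w
  proof -
    have "h \<otimes> \<lbrace>u, v\<rbrace> = - (u \<otimes> \<lbrace>v, h\<rbrace>) - v \<otimes> \<lbrace>h, u\<rbrace>"
      by (rule summand_eq[OF cyclic_mult_br])
    then have "\<lbrace>h, u\<rbrace> \<otimes> v - \<lbrace>h, v\<rbrace> \<otimes> u = - (h \<otimes> \<lbrace>u, v\<rbrace>)"
      using br_skew[of v h] by (simp add: mult_minus_right mult_commute)
    then show ?thesis
      by (metis br_diff_left br_minus_left)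
  qed
  have "?P + ?P = (\<lbrace>h, x\<rbrace> \<otimes> \<lbrace>y, z\<rbrace> + \<lbrace>h, x\<rbrace> \<otimes> \<lbrace>y, z\<rbrace>) + (\<lbrace>h, y\<rbrace> \<otimes> \<lbrace>z, x\<rbrace> + \<lbrace>h, y\<rbrace> \<otimes> \<lbrace>z, x\<rbrace>)
      + (\<lbrace>h, z\<rbrace> \<otimes> \<lbrace>x, y\<rbrace> + \<lbrace>h, z\<rbrace> \<otimes> \<lbrace>x, y\<rbrace>)"
    by (simp only: ac_simps)
  also have "\<dots> = (\<lbrace>\<lbrace>h, x\<rbrace> \<otimes> y, z\<rbrace> - \<lbrace>\<lbrace>h, y\<rbrace> \<otimes> x, z\<rbrace>) + (\<lbrace>\<lbrace>h, y\<rbrace> \<otimes> z, x\<rbrace> - \<lbrace>\<lbrace>h, z\<rbrace> \<otimes> y, x\<rbrace>)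
      + (\<lbrace>\<lbrace>h, z\<rbrace> \<otimes> x, y\<rbrace> - \<lbrace>\<lbrace>h, x\<rbrace> \<otimes> z, y\<rbrace>)"
    unfolding leibniz_skew by simp
  also have "\<dots> = - (\<lbrace>h \<otimes> \<lbrace>x, y\<rbrace>, z\<rbrace> + \<lbrace>h \<otimes> \<lbrace>y, z\<rbrace>, x\<rbrace> + \<lbrace>h \<otimes> \<lbrace>z, x\<rbrace>, y\<rbrace>)"
    unfolding collect by simp
  finally show "?P + ?P = 0" by (simp add: cyclic_br_mult_br)
qed

text \<open>Both sides equal \<open>- (z \<otimes> \<lbrace>x, y\<rbrace>) \<otimes> a\<close>: rotate each summand on the left by
  \<open>cyclic_mult_br\<close> and collect the two brackets that contain \<open>a\<close> by the transposed Leibniz rule. In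
  the fundamental identity this matches the terms in which the operator acts on two of the three inner
  arguments.\<close>

lemma exchange:
  "x \<otimes> \<lbrace>y \<otimes> a, z\<rbrace> + y \<otimes> \<lbrace>z, x \<otimes> a\<rbrace> = (x \<otimes> \<lbrace>y, z\<rbrace> + y \<otimes> \<lbrace>z, x\<rbrace>) \<otimes> a"
proof -
  have 1: "x \<otimes> \<lbrace>y \<otimes> a, z\<rbrace> = - ((y \<otimes> a) \<otimes> \<lbrace>z, x\<rbrace>) - z \<otimes> \<lbrace>x, y \<otimes> a\<rbrace>"
    by (rule summand_eq[OF cyclic_mult_br])
  have 2: "y \<otimes> \<lbrace>z, x \<otimes> a\<rbrace> = - (z \<otimes> \<lbrace>x \<otimes> a, y\<rbrace>) - (x \<otimes> a) \<otimes> \<lbrace>y, z\<rbrace>"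
    by (rule summand_eq[OF cyclic_mult_br])
  have 3: "z \<otimes> \<lbrace>x, y \<otimes> a\<rbrace> + z \<otimes> \<lbrace>x \<otimes> a, y\<rbrace> = a \<otimes> (z \<otimes> \<lbrace>x, y\<rbrace>) + a \<otimes> (z \<otimes> \<lbrace>x, y\<rbrace>)"
  proof -
    have "z \<otimes> (\<lbrace>x, y \<otimes> a\<rbrace> + \<lbrace>x \<otimes> a, y\<rbrace>) = z \<otimes> (a \<otimes> \<lbrace>x, y\<rbrace> + a \<otimes> \<lbrace>x, y\<rbrace>)"
      unfolding leibniz by (simp only: mult_commute[of _ a] add.commute)
    then show ?thesis by (simp only: mult_add_right mult_left_commute[of z])
  qed
  have 4: "a \<otimes> (z \<otimes> \<lbrace>x, y\<rbrace>) = - (a \<otimes> (x \<otimes> \<lbrace>y, z\<rbrace>)) - a \<otimes> (y \<otimes> \<lbrace>z, x\<rbrace>)"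
    unfolding summand_eq[OF cyclic_mult_br, of z x y] by (simp only: mult_diff_right mult_minus_right)
  have "x \<otimes> \<lbrace>y \<otimes> a, z\<rbrace> + y \<otimes> \<lbrace>z, x \<otimes> a\<rbrace>
     = - (a \<otimes> (y \<otimes> \<lbrace>z, x\<rbrace>)) - a \<otimes> (x \<otimes> \<lbrace>y, z\<rbrace>) - (z \<otimes> \<lbrace>x, y \<otimes> a\<rbrace> + z \<otimes> \<lbrace>x \<otimes> a, y\<rbrace>)"
    unfolding 1 2 by (simp add: mult_ac)
  also have "\<dots> = a \<otimes> (x \<otimes> \<lbrace>y, z\<rbrace>) + a \<otimes> (y \<otimes> \<lbrace>z, x\<rbrace>)"
    unfolding 3 4 by simp
  also have "\<dots> = (x \<otimes> \<lbrace>y, z\<rbrace> + y \<otimes> \<lbrace>z, x\<rbrace>) \<otimes> a"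
    by (simp only: mult_add_right mult_commute[of _ a])
  finally show ?thesis .
qed

text \<open>The case \<open>a = \<lbrace>y, z\<rbrace>\<close> of \<open>exchange\<close>, with \<open>\<lbrace>g \<otimes> \<lbrace>y, z\<rbrace>, v\<rbrace>\<close> split by
  \<open>cyclic_br_mult_br\<close>. It matches the terms of the fundamental identity in which the operator
  acts on one outer and one inner argument; the primed version serves the second outer
  argument.\<close>

lemma exchange_nested:
  "g \<otimes> \<lbrace>v, h \<otimes> \<lbrace>y, z\<rbrace>\<rbrace> = (g \<otimes> \<lbrace>v, h\<rbrace>) \<otimes> \<lbrace>y, z\<rbrace> + (h \<otimes> \<lbrace>g, v\<rbrace>) \<otimes> \<lbrace>y, z\<rbrace>
     + h \<otimes> \<lbrace>g \<otimes> \<lbrace>v, y\<rbrace>, z\<rbrace> + h \<otimes> \<lbrace>y, g \<otimes> \<lbrace>v, z\<rbrace>\<rbrace>"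
proof -
  have s: "\<lbrace>y, g \<otimes> \<lbrace>v, z\<rbrace>\<rbrace> = \<lbrace>g \<otimes> \<lbrace>z, v\<rbrace>, y\<rbrace>"
    by (metis br_skew mult_minus_right br_minus_left)
  have "\<lbrace>g \<otimes> \<lbrace>v, y\<rbrace>, z\<rbrace> + \<lbrace>y, g \<otimes> \<lbrace>v, z\<rbrace>\<rbrace> = - \<lbrace>g \<otimes> \<lbrace>y, z\<rbrace>, v\<rbrace>"
    unfolding s using summand_eq[OF cyclic_br_mult_br, of g y z v] by simp
  then have e: "h \<otimes> \<lbrace>g \<otimes> \<lbrace>v, y\<rbrace>, z\<rbrace> + h \<otimes> \<lbrace>y, g \<otimes> \<lbrace>v, z\<rbrace>\<rbrace> = - (h \<otimes> \<lbrace>g \<otimes> \<lbrace>y, z\<rbrace>, v\<rbrace>)"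
    by (metis mult_add_right mult_minus_right)
  have "g \<otimes> \<lbrace>v, h \<otimes> \<lbrace>y, z\<rbrace>\<rbrace>
      = (h \<otimes> \<lbrace>g, v\<rbrace> + g \<otimes> \<lbrace>v, h\<rbrace>) \<otimes> \<lbrace>y, z\<rbrace> - h \<otimes> \<lbrace>g \<otimes> \<lbrace>y, z\<rbrace>, v\<rbrace>"
    unfolding exchange[symmetric] by simp
  then show ?thesis
    using e by (simp add: mult_add_left add.assoc add.left_commute)
qed

lemma exchange_nested':
  "g \<otimes> \<lbrace>h \<otimes> \<lbrace>y, z\<rbrace>, v\<rbrace> = (g \<otimes> \<lbrace>h, v\<rbrace>) \<otimes> \<lbrace>y, z\<rbrace> + (h \<otimes> \<lbrace>v, g\<rbrace>) \<otimes> \<lbrace>y, z\<rbrace>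
     + h \<otimes> \<lbrace>g \<otimes> \<lbrace>y, v\<rbrace>, z\<rbrace> + h \<otimes> \<lbrace>y, g \<otimes> \<lbrace>z, v\<rbrace>\<rbrace>"
  using arg_cong[OF exchange_nested[of g v h y z], of uminus]
  by (simp add: br_skew[of "h \<otimes> \<lbrace>y, z\<rbrace>" v] br_skew[of h v] br_skew[of v g] br_skew[of y v] br_skew[of z v]
      biadditive ac_simps)

section \<open>The fundamental identity of the ternary operation\<close>

definition tri :: "('a \<Rightarrow> 'a) \<Rightarrow> 'a \<Rightarrow> 'a \<Rightarrow> 'a \<Rightarrow> 'a" where
  "tri A x y z = A x \<otimes> \<lbrace>y, z\<rbrace> + A y \<otimes> \<lbrace>z, x\<rbrace> + A z \<otimes> \<lbrace>x, y\<rbrace>"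

text \<open>Besides additivity, \<open>P\<close> needs the Leibniz rule only on products \<open>h \<otimes> \<lbrace>y, z\<rbrace>\<close> multiplied
  by a further element, and there the term in which it meets \<open>h\<close> may involve any operator \<open>S\<close>: the
  products containing \<open>S\<close> are symmetric in the two remaining brackets or cancel by \<open>pluecker\<close>.\<close>

lemma tri_fundamental_identity:
  assumes add: "\<And>x y. P (x + y) = P x + P y"
    and expand: "\<And>h y z a. P (h \<otimes> \<lbrace>y, z\<rbrace>) \<otimes> a
      = (S h \<otimes> \<lbrace>y, z\<rbrace>) \<otimes> a + (h \<otimes> \<lbrace>P y, z\<rbrace>) \<otimes> a + (h \<otimes> \<lbrace>y, P z\<rbrace>) \<otimes> a"
  shows "tri P u v (tri P x y z)
    = tri P (tri P u v x) y z + tri P x (tri P u v y) z + tri P x y (tri P u v z)"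
proof -
  have pl: "(g \<otimes> \<lbrace>h, x\<rbrace>) \<otimes> \<lbrace>y, z\<rbrace> + (g \<otimes> \<lbrace>h, y\<rbrace>) \<otimes> \<lbrace>z, x\<rbrace> + (g \<otimes> \<lbrace>h, z\<rbrace>) \<otimes> \<lbrace>x, y\<rbrace> = 0" for g h
    by (simp only: mult_assoc mult_add_right[symmetric] pluecker mult_0_right)
  have pl': "(g \<otimes> \<lbrace>x, h\<rbrace>) \<otimes> \<lbrace>y, z\<rbrace> + (g \<otimes> \<lbrace>y, h\<rbrace>) \<otimes> \<lbrace>z, x\<rbrace> + (g \<otimes> \<lbrace>z, h\<rbrace>) \<otimes> \<lbrace>x, y\<rbrace> = 0" for g h
    by (simp only: br_skew[of x h] br_skew[of y h] br_skew[of z h] mult_minus_left mult_minus_right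
        minus_add_distrib[symmetric] pl minus_zero)
  have xy: "P x \<otimes> \<lbrace>P y \<otimes> a, z\<rbrace> + P y \<otimes> \<lbrace>z, P x \<otimes> a\<rbrace>
      = (P x \<otimes> \<lbrace>P y, z\<rbrace>) \<otimes> a + (P y \<otimes> \<lbrace>z, P x\<rbrace>) \<otimes> a" for x y z a
    by (simp only: exchange mult_add_left)
  \<comment> \<open>Both sides are expanded and grouped by the two arguments under operators: one of \<open>u\<close>, \<open>v\<close> and
    one of \<open>x\<close>, \<open>y\<close>, \<open>z\<close>; then two of \<open>x\<close>, \<open>y\<close>, \<open>z\<close>; then the terms with \<open>S\<close>; and, on the right
    only, both \<open>u\<close> and \<open>v\<close>.\<close>
  have lhs: "tri P u v (tri P x y z)
    = P u \<otimes> \<lbrace>v, P x \<otimes> \<lbrace>y, z\<rbrace>\<rbrace> + P u \<otimes> \<lbrace>v, P y \<otimes> \<lbrace>z, x\<rbrace>\<rbrace> + P u \<otimes> \<lbrace>v, P z \<otimes> \<lbrace>x, y\<rbrace>\<rbrace>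
    + P v \<otimes> \<lbrace>P x \<otimes> \<lbrace>y, z\<rbrace>, u\<rbrace> + P v \<otimes> \<lbrace>P y \<otimes> \<lbrace>z, x\<rbrace>, u\<rbrace> + P v \<otimes> \<lbrace>P z \<otimes> \<lbrace>x, y\<rbrace>, u\<rbrace>
    + ((P x \<otimes> \<lbrace>P y, z\<rbrace>) \<otimes> \<lbrace>u, v\<rbrace> + (P y \<otimes> \<lbrace>z, P x\<rbrace>) \<otimes> \<lbrace>u, v\<rbrace>)
    + ((P y \<otimes> \<lbrace>P z, x\<rbrace>) \<otimes> \<lbrace>u, v\<rbrace> + (P z \<otimes> \<lbrace>x, P y\<rbrace>) \<otimes> \<lbrace>u, v\<rbrace>)
    + ((P z \<otimes> \<lbrace>P x, y\<rbrace>) \<otimes> \<lbrace>u, v\<rbrace> + (P x \<otimes> \<lbrace>y, P z\<rbrace>) \<otimes> \<lbrace>u, v\<rbrace>)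
    + ((S (P x) \<otimes> \<lbrace>y, z\<rbrace>) \<otimes> \<lbrace>u, v\<rbrace> + (S (P y) \<otimes> \<lbrace>z, x\<rbrace>) \<otimes> \<lbrace>u, v\<rbrace> + (S (P z) \<otimes> \<lbrace>x, y\<rbrace>) \<otimes> \<lbrace>u, v\<rbrace>)"
    by (simp only: tri_def add mult_add_left mult_add_right br_add_left br_add_right expand ac_simps)
  have s: "(S (P x) \<otimes> \<lbrace>y, z\<rbrace>) \<otimes> \<lbrace>u, v\<rbrace> = (S (P x) \<otimes> \<lbrace>u, v\<rbrace>) \<otimes> \<lbrace>y, z\<rbrace>" for x y z
    by (metis mult_assoc mult_commute)
  have rhs: "tri P (tri P u v x) y z + tri P x (tri P u v y) z + tri P x y (tri P u v z)
    = ((P u \<otimes> \<lbrace>v, P x\<rbrace>) \<otimes> \<lbrace>y, z\<rbrace> + (P x \<otimes> \<lbrace>P u, v\<rbrace>) \<otimes> \<lbrace>y, z\<rbrace>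
         + P x \<otimes> \<lbrace>P u \<otimes> \<lbrace>v, y\<rbrace>, z\<rbrace> + P x \<otimes> \<lbrace>y, P u \<otimes> \<lbrace>v, z\<rbrace>\<rbrace>)
    + ((P u \<otimes> \<lbrace>v, P y\<rbrace>) \<otimes> \<lbrace>z, x\<rbrace> + (P y \<otimes> \<lbrace>P u, v\<rbrace>) \<otimes> \<lbrace>z, x\<rbrace>
         + P y \<otimes> \<lbrace>P u \<otimes> \<lbrace>v, z\<rbrace>, x\<rbrace> + P y \<otimes> \<lbrace>z, P u \<otimes> \<lbrace>v, x\<rbrace>\<rbrace>)
    + ((P u \<otimes> \<lbrace>v, P z\<rbrace>) \<otimes> \<lbrace>x, y\<rbrace> + (P z \<otimes> \<lbrace>P u, v\<rbrace>) \<otimes> \<lbrace>x, y\<rbrace>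
         + P z \<otimes> \<lbrace>P u \<otimes> \<lbrace>v, x\<rbrace>, y\<rbrace> + P z \<otimes> \<lbrace>x, P u \<otimes> \<lbrace>v, y\<rbrace>\<rbrace>)
    + ((P v \<otimes> \<lbrace>P x, u\<rbrace>) \<otimes> \<lbrace>y, z\<rbrace> + (P x \<otimes> \<lbrace>u, P v\<rbrace>) \<otimes> \<lbrace>y, z\<rbrace>
         + P x \<otimes> \<lbrace>P v \<otimes> \<lbrace>y, u\<rbrace>, z\<rbrace> + P x \<otimes> \<lbrace>y, P v \<otimes> \<lbrace>z, u\<rbrace>\<rbrace>)
    + ((P v \<otimes> \<lbrace>P y, u\<rbrace>) \<otimes> \<lbrace>z, x\<rbrace> + (P y \<otimes> \<lbrace>u, P v\<rbrace>) \<otimes> \<lbrace>z, x\<rbrace>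
         + P y \<otimes> \<lbrace>P v \<otimes> \<lbrace>z, u\<rbrace>, x\<rbrace> + P y \<otimes> \<lbrace>z, P v \<otimes> \<lbrace>x, u\<rbrace>\<rbrace>)
    + ((P v \<otimes> \<lbrace>P z, u\<rbrace>) \<otimes> \<lbrace>x, y\<rbrace> + (P z \<otimes> \<lbrace>u, P v\<rbrace>) \<otimes> \<lbrace>x, y\<rbrace>
         + P z \<otimes> \<lbrace>P v \<otimes> \<lbrace>x, u\<rbrace>, y\<rbrace> + P z \<otimes> \<lbrace>x, P v \<otimes> \<lbrace>y, u\<rbrace>\<rbrace>)
    + (P x \<otimes> \<lbrace>P y \<otimes> \<lbrace>u, v\<rbrace>, z\<rbrace> + P y \<otimes> \<lbrace>z, P x \<otimes> \<lbrace>u, v\<rbrace>\<rbrace>)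
    + (P y \<otimes> \<lbrace>P z \<otimes> \<lbrace>u, v\<rbrace>, x\<rbrace> + P z \<otimes> \<lbrace>x, P y \<otimes> \<lbrace>u, v\<rbrace>\<rbrace>)
    + (P z \<otimes> \<lbrace>P x \<otimes> \<lbrace>u, v\<rbrace>, y\<rbrace> + P x \<otimes> \<lbrace>y, P z \<otimes> \<lbrace>u, v\<rbrace>\<rbrace>)
    + ((S (P x) \<otimes> \<lbrace>u, v\<rbrace>) \<otimes> \<lbrace>y, z\<rbrace> + (S (P y) \<otimes> \<lbrace>u, v\<rbrace>) \<otimes> \<lbrace>z, x\<rbrace> + (S (P z) \<otimes> \<lbrace>u, v\<rbrace>) \<otimes> \<lbrace>x, y\<rbrace>)
    + ((S (P u) \<otimes> \<lbrace>v, x\<rbrace>) \<otimes> \<lbrace>y, z\<rbrace> + (S (P u) \<otimes> \<lbrace>v, y\<rbrace>) \<otimes> \<lbrace>z, x\<rbrace> + (S (P u) \<otimes> \<lbrace>v, z\<rbrace>) \<otimes> \<lbrace>x, y\<rbrace>)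
    + ((S (P v) \<otimes> \<lbrace>x, u\<rbrace>) \<otimes> \<lbrace>y, z\<rbrace> + (S (P v) \<otimes> \<lbrace>y, u\<rbrace>) \<otimes> \<lbrace>z, x\<rbrace> + (S (P v) \<otimes> \<lbrace>z, u\<rbrace>) \<otimes> \<lbrace>x, y\<rbrace>)
    + ((P u \<otimes> \<lbrace>P v, x\<rbrace>) \<otimes> \<lbrace>y, z\<rbrace> + (P u \<otimes> \<lbrace>P v, y\<rbrace>) \<otimes> \<lbrace>z, x\<rbrace> + (P u \<otimes> \<lbrace>P v, z\<rbrace>) \<otimes> \<lbrace>x, y\<rbrace>)
    + ((P v \<otimes> \<lbrace>x, P u\<rbrace>) \<otimes> \<lbrace>y, z\<rbrace> + (P v \<otimes> \<lbrace>y, P u\<rbrace>) \<otimes> \<lbrace>z, x\<rbrace> + (P v \<otimes> \<lbrace>z, P u\<rbrace>) \<otimes> \<lbrace>x, y\<rbrace>)"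
    by (simp only: tri_def add mult_add_left mult_add_right br_add_left br_add_right expand ac_simps)
  show ?thesis
    unfolding lhs rhs exchange_nested[symmetric] exchange_nested'[symmetric] pl pl' xy s
    by (simp only: add_0_right)
qed

text \<open>By the transposed Leibniz rule \<open>2 E x \<otimes> \<lbrace>y, z\<rbrace> = \<lbrace>E x \<otimes> y, z\<rbrace> - \<lbrace>E x \<otimes> z, y\<rbrace>\<close>, and the
  products \<open>E x \<otimes> y\<close> are symmetric in \<open>x\<close> and \<open>y\<close>, so the cyclic sum telescopes.\<close>

lemma tri_eq_0_if_symmetric:
  assumes "\<And>x y. E x \<otimes> y = x \<otimes> E y"
  shows "tri E x y z = 0"
proof (rule double_eq_0)
  have "tri E x y z + tri E x y z = (E x \<otimes> \<lbrace>y, z\<rbrace> + E x \<otimes> \<lbrace>y, z\<rbrace>) + (E y \<otimes> \<lbrace>z, x\<rbrace> + E y \<otimes> \<lbrace>z, x\<rbrace>)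
      + (E z \<otimes> \<lbrace>x, y\<rbrace> + E z \<otimes> \<lbrace>x, y\<rbrace>)"
    by (simp only: tri_def ac_simps)
  also have "\<dots> = 0"
    unfolding leibniz_skew using assms by (simp add: mult_commute)
  finally show "tri E x y z + tri E x y z = 0" .
qed

section \<open>Twisted derivations\<close>

text \<open>A derivation of both operations is the case \<open>A = B\<close>.\<close>

definition twisted_derivation :: "('a \<Rightarrow> 'a) \<Rightarrow> ('a \<Rightarrow> 'a) \<Rightarrow> bool" where
  "twisted_derivation A B \<longleftrightarrow>
     (\<forall>x y. A (x + y) = A x + A y) \<and>
     (\<forall>x y. A (x \<otimes> y) = B x \<otimes> y + x \<otimes> B y) \<and>
     (\<forall>x y. A \<lbrace>x, y\<rbrace> = \<lbrace>B x, y\<rbrace> + \<lbrace>x, B y\<rbrace>)"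

lemma twisted_derivationD:
  assumes "twisted_derivation A B"
  shows "A (x + y) = A x + A y" "A (x \<otimes> y) = B x \<otimes> y + x \<otimes> B y" "A \<lbrace>x, y\<rbrace> = \<lbrace>B x, y\<rbrace> + \<lbrace>x, B y\<rbrace>"
  using assms by (auto simp: twisted_derivation_def)

text \<open>Evaluate \<open>A ((x \<otimes> y) \<otimes> z) = A (x \<otimes> (y \<otimes> z))\<close> on both sides: in a product of three factors the
  factor outside the inner product meets \<open>B\<close>, the other two meet \<open>C\<close>.\<close>

lemma twisted_derivation_shift:
  assumes AB: "twisted_derivation A B" and BC: "twisted_derivation B C"
  shows "(B x - C x) \<otimes> (y \<otimes> z) = x \<otimes> (y \<otimes> (B z - C z))"
proof -
  have "(C x \<otimes> y + x \<otimes> C y) \<otimes> z + (x \<otimes> y) \<otimes> B z = A ((x \<otimes> y) \<otimes> z)"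
    by (simp only: twisted_derivationD[OF AB] twisted_derivationD[OF BC])
  also have "\<dots> = A (x \<otimes> (y \<otimes> z))"
    by (simp only: mult_assoc)
  also have "\<dots> = B x \<otimes> (y \<otimes> z) + x \<otimes> (C y \<otimes> z + y \<otimes> C z)"
    by (simp only: twisted_derivationD[OF AB] twisted_derivationD[OF BC])
  finally have "C x \<otimes> (y \<otimes> z) + x \<otimes> (y \<otimes> B z) = B x \<otimes> (y \<otimes> z) + x \<otimes> (y \<otimes> C z)"
    by (simp add: mult_add_left mult_add_right mult_assoc ac_simps)
  then show ?thesis
    by (simp add: mult_diff_left mult_diff_right algebra_simps)
qed

text \<open>Apply \<open>A\<close> to \<open>cyclic_mult_br\<close>. The terms with \<open>B\<close> form \<open>tri B\<close>; those with \<open>C\<close> regroup, by the same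
  identity, to \<open>- tri C\<close>.\<close>

lemma tri_twisted_derivation:
  assumes AB: "twisted_derivation A B" and BC: "twisted_derivation B C"
  shows "tri B x y z = tri C x y z"
proof -
  have "0 = A (x \<otimes> \<lbrace>y, z\<rbrace> + y \<otimes> \<lbrace>z, x\<rbrace> + z \<otimes> \<lbrace>x, y\<rbrace>)"
    using twisted_derivationD(1)[OF AB, of 0 0] by (simp add: cyclic_mult_br)
  also have "\<dots> = tri B x y z + (x \<otimes> \<lbrace>C y, z\<rbrace> + z \<otimes> \<lbrace>x, C y\<rbrace>)
      + (y \<otimes> \<lbrace>C z, x\<rbrace> + x \<otimes> \<lbrace>y, C z\<rbrace>) + (z \<otimes> \<lbrace>C x, y\<rbrace> + y \<otimes> \<lbrace>z, C x\<rbrace>)"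
    by (simp only: tri_def twisted_derivationD[OF AB] twisted_derivationD[OF BC] mult_add_right ac_simps)
  also have "\<dots> = tri B x y z - tri C x y z"
  proof -
    have "p \<otimes> \<lbrace>C q, r\<rbrace> + r \<otimes> \<lbrace>p, C q\<rbrace> = - (C q \<otimes> \<lbrace>r, p\<rbrace>)" for p q r
      using summand_eq[OF cyclic_mult_br, of p "C q" r] by simp
    then show ?thesis by (simp add: tri_def)
  qed
  finally show ?thesis by simp
qed

text \<open>On \<open>h \<otimes> \<lbrace>y, z\<rbrace>\<close> the operator \<open>C\<close> produces \<open>E \<lbrace>y, z\<rbrace>\<close>, whereas the Leibniz rule asks for
  \<open>\<lbrace>C y, z\<rbrace> + \<lbrace>y, C z\<rbrace> = B \<lbrace>y, z\<rbrace>\<close>. After multiplication by a further element the difference \<open>B - E\<close> can be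
  shifted from the bracket to \<open>h\<close>, where the general fundamental identity tolerates it.\<close>

lemma tri_fundamental_identity_twisted_derivation:
  assumes AB: "twisted_derivation A B" and BC: "twisted_derivation B C" and CE: "twisted_derivation C E"
  shows "tri C u v (tri C x y z)
    = tri C (tri C u v x) y z + tri C x (tri C u v y) z + tri C x y (tri C u v z)"
proof (rule tri_fundamental_identity[where S = "\<lambda>h. E h + E h - B h"])
  show "C (x + y) = C x + C y" for x y
    by (rule twisted_derivationD[OF CE])
  fix h y z a
  let ?b = "\<lbrace>y, z\<rbrace>"
  have "(B h - E h) \<otimes> (a \<otimes> ?b) = (B h - C h) \<otimes> (a \<otimes> ?b) + (C h - E h) \<otimes> (a \<otimes> ?b)"
    by (simp flip: mult_add_left)
  also have "\<dots> = h \<otimes> (a \<otimes> (B ?b - C ?b)) + h \<otimes> (a \<otimes> (C ?b - E ?b))"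
    by (simp only: twisted_derivation_shift[OF AB BC] twisted_derivation_shift[OF BC CE])
  also have "\<dots> = h \<otimes> (a \<otimes> (B ?b - E ?b))"
    by (simp flip: mult_add_right)
  finally have "h \<otimes> (a \<otimes> E ?b) = h \<otimes> (a \<otimes> B ?b) - (B h - E h) \<otimes> (a \<otimes> ?b)"
    by (simp add: mult_diff_right)
  then have "(h \<otimes> E ?b) \<otimes> a = (h \<otimes> B ?b) \<otimes> a - ((B h - E h) \<otimes> ?b) \<otimes> a"
    by (simp only: mult_assoc mult_commute[of a])
  then show "C (h \<otimes> ?b) \<otimes> a
      = ((E h + E h - B h) \<otimes> ?b) \<otimes> a + (h \<otimes> \<lbrace>C y, z\<rbrace>) \<otimes> a + (h \<otimes> \<lbrace>y, C z\<rbrace>) \<otimes> a"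
    by (simp add: twisted_derivationD[OF CE] twisted_derivationD(3)[OF BC]
        mult_add_left mult_add_right mult_diff_left algebra_simps)
qed

section \<open>Averages and conjugates of operators\<close>

definition half :: "'a \<Rightarrow> 'a" where
  "half a = (THE b. b + b = a)"

lemma half_double: "half a + half a = a"
  unfolding half_def by (rule theI'[OF unique_half])

lemma half_eqI: "b + b = a \<Longrightarrow> half a = b"
  by (rule double_cancel) (simp add: half_double)

lemma half_add: "half (a + b) = half a + half b"
proof (rule half_eqI)
  have "half a + half b + (half a + half b) = (half a + half a) + (half b + half b)"
    by (simp only: ac_simps)
  then show "half a + half b + (half a + half b) = a + b" by (simp only: half_double)
qed

lemma half_mult_left: "half a \<otimes> b = half (a \<otimes> b)"
  by (rule half_eqI[symmetric]) (simp only: mult_add_left[symmetric] half_double)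

lemma half_mult_right: "b \<otimes> half a = half (b \<otimes> a)"
  by (rule half_eqI[symmetric]) (simp only: mult_add_right[symmetric] half_double)

lemma half_br_left: "\<lbrace>half a, b\<rbrace> = half \<lbrace>a, b\<rbrace>"
  by (rule half_eqI[symmetric]) (simp only: br_add_left[symmetric] half_double)

lemma half_br_right: "\<lbrace>b, half a\<rbrace> = half \<lbrace>b, a\<rbrace>"
  by (rule half_eqI[symmetric]) (simp only: br_add_right[symmetric] half_double)

definition average :: "('a \<Rightarrow> 'a) \<Rightarrow> ('a \<Rightarrow> 'a) \<Rightarrow> 'a \<Rightarrow> 'a" where
  "average A B x = half (A x + B x)"

lemma tri_average: "tri (average A B) x y z = half (tri A x y z + tri B x y z)"
  by (simp only: tri_def average_def half_mult_left half_add[symmetric] mult_add_left ac_simps)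

lemma twisted_derivation_average:
  assumes "twisted_derivation A B" "twisted_derivation A' B'"
  shows "twisted_derivation (average A A') (average B B')"
  unfolding twisted_derivation_def average_def
    twisted_derivationD[OF assms(1)] twisted_derivationD[OF assms(2)]
    half_mult_left half_mult_right half_br_left half_br_right half_add[symmetric]
  by (simp only: mult_add_left mult_add_right br_add_left br_add_right ac_simps) simp

definition automorphism :: "('a \<Rightarrow> 'a) \<Rightarrow> bool" where
  "automorphism \<phi> \<longleftrightarrow> bij \<phi> \<and> (\<forall>x y. \<phi> (x + y) = \<phi> x + \<phi> y) \<and>
     (\<forall>x y. \<phi> (x \<otimes> y) = \<phi> x \<otimes> \<phi> y) \<and> (\<forall>x y. \<phi> \<lbrace>x, y\<rbrace> = \<lbrace>\<phi> x, \<phi> y\<rbrace>)"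

lemma automorphismD:
  assumes "automorphism \<phi>"
  shows "\<phi> (x + y) = \<phi> x + \<phi> y" "\<phi> (x \<otimes> y) = \<phi> x \<otimes> \<phi> y" "\<phi> \<lbrace>x, y\<rbrace> = \<lbrace>\<phi> x, \<phi> y\<rbrace>"
    "inv \<phi> (\<phi> x) = x" "\<phi> (inv \<phi> x) = x"
  using assms by (auto simp: automorphism_def bij_is_inj bij_is_surj surj_f_inv_f)

lemma automorphism_inv:
  assumes "automorphism \<phi>"
  shows "inv \<phi> (x + y) = inv \<phi> x + inv \<phi> y" "inv \<phi> (x \<otimes> y) = inv \<phi> x \<otimes> inv \<phi> y"
    "inv \<phi> \<lbrace>x, y\<rbrace> = \<lbrace>inv \<phi> x, inv \<phi> y\<rbrace>"
  by (metis automorphismD[OF assms])+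

definition conjugate :: "('a \<Rightarrow> 'a) \<Rightarrow> ('a \<Rightarrow> 'a) \<Rightarrow> 'a \<Rightarrow> 'a" where
  "conjugate \<phi> A x = \<phi> (A (inv \<phi> x))"

lemma tri_conjugate:
  assumes "automorphism \<phi>"
  shows "tri (conjugate \<phi> A) x y z = \<phi> (tri A (inv \<phi> x) (inv \<phi> y) (inv \<phi> z))"
  by (simp add: tri_def conjugate_def automorphismD[OF assms])

lemma twisted_derivation_conjugate:
  assumes "automorphism \<phi>" and "twisted_derivation A B"
  shows "twisted_derivation (conjugate \<phi> A) (conjugate \<phi> B)"
  by (simp add: twisted_derivation_def conjugate_def automorphism_inv[OF assms(1)]
      twisted_derivationD[OF assms(2)] automorphismD[OF assms(1)])

section \<open>Derivations up to two commuting automorphisms\<close>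

definition conjugate_average :: "('a \<Rightarrow> 'a) \<Rightarrow> ('a \<Rightarrow> 'a) \<Rightarrow> ('a \<Rightarrow> 'a) \<Rightarrow> 'a \<Rightarrow> 'a" where
  "conjugate_average \<phi> \<psi> A = average (conjugate \<phi> A) (conjugate \<psi> A)"

context
  fixes \<phi> \<psi> D :: "'a \<Rightarrow> 'a"
  assumes phi: "automorphism \<phi>" and psi: "automorphism \<psi>" and commute: "\<phi> \<circ> \<psi> = \<psi> \<circ> \<phi>"
    and D_add: "D (x + y) = D x + D y"
    and D_mult: "D (x \<otimes> y) = conjugate \<phi> D x \<otimes> y + x \<otimes> conjugate \<psi> D y"
    and D_br: "D \<lbrace>x, y\<rbrace> = \<lbrace>conjugate \<phi> D x, y\<rbrace> + \<lbrace>x, conjugate \<psi> D y\<rbrace>"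
begin

abbreviation mean where "mean \<equiv> conjugate_average \<phi> \<psi>"

lemma twisted_derivation_mean:
  "twisted_derivation A B \<Longrightarrow> twisted_derivation (mean A) (mean B)"
  unfolding conjugate_average_def
  by (intro twisted_derivation_average twisted_derivation_conjugate phi psi)

text \<open>Symmetry of the operations also gives the Leibniz rules with the two conjugates interchanged;
  average both versions.\<close>

lemma twisted_derivation_mean_self: "twisted_derivation D (mean D)"
proof -
  let ?A = "conjugate \<phi> D" and ?B = "conjugate \<psi> D"
  have m: "D (x \<otimes> y) = ?B x \<otimes> y + x \<otimes> ?A y" for x y
    using D_mult[of y x] by (simp only: mult_commute[of y] mult_commute[of _ x] add.commute)
  have "D (- a) = - D a" for a
    using D_add[of a "- a"] D_add[of 0 0] by (simp add: eq_neg_iff_add_eq_0 add.commute)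
  then have "D \<lbrace>x, y\<rbrace> = - D \<lbrace>y, x\<rbrace>" for x y
    by (metis br_skew)
  also have "- D \<lbrace>y, x\<rbrace> = \<lbrace>?B x, y\<rbrace> + \<lbrace>x, ?A y\<rbrace>" for x y
    using br_skew[of x "?A y"] br_skew[of "?B x" y] by (simp add: D_br add.commute)
  finally have b: "D \<lbrace>x, y\<rbrace> = \<lbrace>?B x, y\<rbrace> + \<lbrace>x, ?A y\<rbrace>" for x y .
  have "D (x \<otimes> y) + D (x \<otimes> y) = (?A x + ?B x) \<otimes> y + x \<otimes> (?A y + ?B y)" for x y
    by (subst m, subst D_mult) (simp only: mult_add_left mult_add_right ac_simps)
  note mean_mult = half_eqI[OF this, symmetric]
  have "D \<lbrace>x, y\<rbrace> + D \<lbrace>x, y\<rbrace> = \<lbrace>?A x + ?B x, y\<rbrace> + \<lbrace>x, ?A y + ?B y\<rbrace>" for x y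
    by (subst b, subst D_br) (simp only: br_add_left br_add_right ac_simps)
  note mean_br = half_eqI[OF this, symmetric]
  show ?thesis
    by (simp add: twisted_derivation_def conjugate_average_def average_def D_add half_mult_left half_mult_right
        half_br_left half_br_right mean_mult mean_br flip: half_add)
qed

text \<open>Comparing the two Leibniz rules for \<open>D (x \<otimes> y)\<close> shows that the difference of the
  conjugates is symmetric for the product.\<close>

lemma tri_conjugate_eq: "tri (conjugate \<phi> D) x y z = tri (conjugate \<psi> D) x y z"
proof -
  let ?E = "\<lambda>x. conjugate \<phi> D x - conjugate \<psi> D x"
  have "?E x \<otimes> y = x \<otimes> ?E y" for x y
    using D_mult[of x y] D_mult[of y x] by (simp add: biadditive mult_commute algebra_simps)
  then have "tri ?E x y z = 0" by (rule tri_eq_0_if_symmetric)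
  then show ?thesis by (simp add: tri_def mult_diff_left algebra_simps)
qed

lemma tri_mean: "tri (conjugate \<phi> D) x y z = tri (mean D) x y z"
  by (simp add: conjugate_average_def tri_average tri_conjugate_eq half_eqI)

lemma tri_mean_mean: "tri (mean (mean D)) x y z = tri (mean D) x y z"
  using tri_twisted_derivation[OF twisted_derivation_mean_self twisted_derivation_mean[OF twisted_derivation_mean_self]]
  by simp

text \<open>The operators \<open>mean (mean D)\<close> and \<open>conjugate \<phi> D\<close> define the same ternary operation. The first
  one is an average of double conjugates of \<open>D\<close>, which all define the same operation as well; so
  conjugating once more by \<open>\<phi>\<close> or \<open>\<psi>\<close> changes nothing.\<close>

lemma tri_invariant:
  shows "\<phi> (tri (conjugate \<phi> D) x y z) = tri (conjugate \<phi> D) (\<phi> x) (\<phi> y) (\<phi> z)"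
    and "\<psi> (tri (conjugate \<phi> D) x y z) = tri (conjugate \<phi> D) (\<psi> x) (\<psi> y) (\<psi> z)"
proof -
  let ?T = "tri (conjugate \<phi> D)"
  have comm: "conjugate \<phi> (conjugate \<psi> D) = conjugate \<psi> (conjugate \<phi> D)"
  proof -
    have "\<phi> (\<psi> x) = \<psi> (\<phi> x)" for x using commute by (metis comp_apply)
    moreover from this have "inv \<phi> (inv \<psi> x) = inv \<psi> (inv \<phi> x)" for x
      by (metis automorphismD(4,5)[OF phi] automorphismD(4,5)[OF psi])
    ultimately show ?thesis by (simp add: fun_eq_iff conjugate_def)
  qed
  have eq: "tri (conjugate \<phi> (conjugate \<phi> D)) x y z = tri (conjugate \<psi> (conjugate \<phi> D)) x y z" for x y z
    unfolding comm[symmetric] tri_conjugate[OF phi, of "conjugate _ D"] tri_conjugate_eq ..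
  have "tri (conjugate \<phi> (mean D)) x y z = tri (conjugate \<phi> (conjugate \<phi> D)) x y z"
    and "tri (conjugate \<psi> (mean D)) x y z = tri (conjugate \<psi> (conjugate \<phi> D)) x y z" for x y z
    by (simp_all only: tri_conjugate[OF phi, of "mean D"] tri_conjugate[OF phi, of "conjugate \<phi> D"]
        tri_conjugate[OF psi, of "mean D"] tri_conjugate[OF psi, of "conjugate \<phi> D"] tri_mean)
  moreover have "?T x y z = tri (mean (mean D)) x y z" for x y z
    by (simp only: tri_mean tri_mean_mean)
  ultimately have "?T x y z
      = half (tri (conjugate \<phi> (conjugate \<phi> D)) x y z + tri (conjugate \<psi> (conjugate \<phi> D)) x y z)" for x y z
    by (simp only: conjugate_average_def[of \<phi> \<psi> "mean D"] tri_average)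
  then have T_phi: "?T x y z = tri (conjugate \<phi> (conjugate \<phi> D)) x y z" for x y z
    by (simp only: eq half_eqI[OF refl])
  show "\<phi> (?T x y z) = ?T (\<phi> x) (\<phi> y) (\<phi> z)"
    unfolding T_phi[of "\<phi> x"] tri_conjugate[OF phi, of "conjugate \<phi> D"]
    by (simp only: automorphismD[OF phi])
  show "\<psi> (?T x y z) = ?T (\<psi> x) (\<psi> y) (\<psi> z)"
    unfolding T_phi[of "\<psi> x"] eq tri_conjugate[OF psi, of "conjugate \<phi> D"]
    by (simp only: automorphismD[OF psi])
qed

lemma tri_fundamental_identity_conjugate:
  "tri (conjugate \<phi> D) u v (tri (conjugate \<phi> D) x y z)
    = tri (conjugate \<phi> D) (tri (conjugate \<phi> D) u v x) y z
    + tri (conjugate \<phi> D) x (tri (conjugate \<phi> D) u v y) z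
    + tri (conjugate \<phi> D) x y (tri (conjugate \<phi> D) u v z)"
  unfolding tri_mean unfolding tri_mean_mean[symmetric]
  by (intro tri_fundamental_identity_twisted_derivation[of D "mean D" _ "mean (mean (mean D))"]
      twisted_derivation_mean_self twisted_derivation_mean)

end

end

section \<open>Removing the twist from a regular transposed BiHom-Poisson algebra\<close>

context regular_transposed_bihom_poisson_algebra
begin

lemma inv_alpha [simp]: "inv \<alpha> (\<alpha> x) = x" "\<alpha> (inv \<alpha> x) = x"
  using bij_alpha by (simp_all add: bij_is_inj bij_is_surj surj_f_inv_f)

lemma inv_beta [simp]: "inv \<beta> (\<beta> x) = x" "\<beta> (inv \<beta> x) = x"
  using bij_beta by (simp_all add: bij_is_inj bij_is_surj surj_f_inv_f)

lemma beta_alpha: "\<beta> (\<alpha> x) = \<alpha> (\<beta> x)"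
  using alpha_beta_commute by (metis comp_apply)

lemma inv_beta_alpha: "inv \<beta> (\<alpha> x) = \<alpha> (inv \<beta> x)"
  by (metis inv_beta beta_alpha)

lemma inv_alpha_beta: "inv \<alpha> (\<beta> x) = \<beta> (inv \<alpha> x)"
  by (metis inv_alpha beta_alpha)

lemma linear_op:
  "mult (x + y) z = mult x z + mult y z" "mult x (y + z) = mult x y + mult x z"
  "mult (scale c x) z = scale c (mult x z)" "mult x (scale c y) = scale c (mult x y)"
  "br (x + y) z = br x z + br y z" "br x (y + z) = br x y + br x z"
  "br (scale c x) z = scale c (br x z)" "br x (scale c y) = scale c (br x y)"
  "\<alpha> (x + y) = \<alpha> x + \<alpha> y" "\<alpha> (scale c x) = scale c (\<alpha> x)"
  "\<beta> (x + y) = \<beta> x + \<beta> y" "\<beta> (scale c x) = scale c (\<beta> x)"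
  using bilinear_mult bilinear_br linear_alpha linear_beta
  unfolding bilinear_op_def by (simp_all add: Vector_Spaces.linear_iff)

lemma linear_inv:
  "inv \<alpha> (x + y) = inv \<alpha> x + inv \<alpha> y" "inv \<alpha> (scale c x) = scale c (inv \<alpha> x)"
  "inv \<beta> (x + y) = inv \<beta> x + inv \<beta> y" "inv \<beta> (scale c x) = scale c (inv \<beta> x)"
  by (metis linear_op inv_alpha inv_beta)+

definition untwisted_mult :: "'a \<Rightarrow> 'a \<Rightarrow> 'a" where
  "untwisted_mult x y = mult (inv \<alpha> x) (inv \<beta> y)"

definition untwisted_br :: "'a \<Rightarrow> 'a \<Rightarrow> 'a" where
  "untwisted_br x y = br (inv \<alpha> x) (inv \<beta> y)"

lemma inv_mult_br:
  "inv \<alpha> (mult x y) = mult (inv \<alpha> x) (inv \<alpha> y)" "inv \<beta> (mult x y) = mult (inv \<beta> x) (inv \<beta> y)"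
  "inv \<alpha> (br x y) = br (inv \<alpha> x) (inv \<alpha> y)" "inv \<beta> (br x y) = br (inv \<beta> x) (inv \<beta> y)"
  by (metis inv_alpha inv_beta alpha_mult beta_mult alpha_br beta_br)+

lemma inv_commute: "inv \<beta> (inv \<alpha> x) = inv \<alpha> (inv \<beta> x)"
  by (metis inv_alpha inv_beta beta_alpha)

lemmas twist_simps = alpha_mult beta_mult alpha_br beta_br inv_mult_br
  beta_alpha inv_beta_alpha inv_alpha_beta inv_commute

lemma double_scale: "x + x = scale 2 x"
  using scale_left_distrib[of 1 1 x] by simp

sublocale untwisted: transposed_poisson_ring untwisted_mult untwisted_br
proof
  fix a x y z :: 'a
  show "\<exists>!b. b + b = a"
  proof
    show "scale (1 / 2) a + scale (1 / 2) a = a" by (simp add: double_scale)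
    show "b = scale (1 / 2) a" if "b + b = a" for b
      using that[symmetric] by (simp add: double_scale)
  qed
  show "untwisted_mult (x + y) z = untwisted_mult x z + untwisted_mult y z"
    and "untwisted_br (x + y) z = untwisted_br x z + untwisted_br y z"
    by (simp_all add: untwisted_mult_def untwisted_br_def linear_inv linear_op)
  \<comment> \<open>Each remaining axiom is a BiHom axiom whose arguments are shifted by inverse powers of \<open>\<alpha>\<close> and
    \<open>\<beta>\<close>; writing \<open>x\<close>, \<open>y\<close>, \<open>z\<close> as images under \<open>\<alpha>\<^sup>2\<beta>\<^sup>2\<close> makes all exponents nonnegative.\<close>
  have preimage: "\<exists>w'. w = \<alpha> (\<alpha> (\<beta> (\<beta> w')))" for w
    by (metis inv_alpha(2) inv_beta(2))
  obtain x' y' z' where xyz: "x = \<alpha> (\<alpha> (\<beta> (\<beta> x')))" "y = \<alpha> (\<alpha> (\<beta> (\<beta> y')))" "z = \<alpha> (\<alpha> (\<beta> (\<beta> z')))"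
    using preimage by meson
  note defs = untwisted_mult_def untwisted_br_def xyz
  show "untwisted_mult x y = untwisted_mult y x"
    using bihom_commute[of "\<alpha> (\<beta> x')" "\<alpha> (\<beta> y')"] by (simp add: defs twist_simps)
  show "untwisted_br x y = - untwisted_br y x"
    using bihom_skew[of "\<alpha> (\<beta> x')" "\<alpha> (\<beta> y')"] by (simp add: defs twist_simps)
  show "untwisted_mult (untwisted_mult x y) z = untwisted_mult x (untwisted_mult y z)"
    using bihom_assoc[of "\<beta> (\<beta> x')" "\<alpha> (\<beta> y')" "\<alpha> (\<alpha> z')"] by (simp add: defs twist_simps)
  show "untwisted_br (untwisted_br x y) z + untwisted_br (untwisted_br y z) x + untwisted_br (untwisted_br z x) y = 0"
    using bihom_jacobi[of "\<beta> x'" "\<beta> y'" "\<beta> z'"] by (simp add: defs twist_simps)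
  show "untwisted_mult x (untwisted_br y z) + untwisted_mult x (untwisted_br y z)
      = untwisted_br (untwisted_mult x y) z + untwisted_br y (untwisted_mult x z)"
    using transposed_leibniz[of "\<beta> x'" "\<alpha> (\<beta> y')" "\<alpha> (\<alpha> z')"] by (simp add: defs twist_simps double_scale)
qed

lemma automorphism_alpha: "untwisted.automorphism \<alpha>"
  by (simp add: untwisted.automorphism_def bij_alpha linear_op untwisted_mult_def untwisted_br_def twist_simps)

lemma automorphism_beta: "untwisted.automorphism \<beta>"
  by (simp add: untwisted.automorphism_def bij_beta linear_op untwisted_mult_def untwisted_br_def twist_simps)

section \<open>The 3-BiHom-Lie algebra of a derivation\<close>

definition derivation_tri :: "('a \<Rightarrow> 'a) \<Rightarrow> 'a \<Rightarrow> 'a \<Rightarrow> 'a \<Rightarrow> 'a" where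
  "derivation_tri D x y z = mult (D x) (br (inv \<beta> y) (inv \<beta> z))
      + mult (D y) (br (inv \<alpha> z) (\<alpha> (inv \<beta> (inv \<beta> x))))
      + mult (D (inv \<alpha> (\<beta> z))) (br (inv \<beta> x) (\<alpha> (inv \<beta> (inv \<beta> y))))"

context
  fixes D :: "'a \<Rightarrow> 'a"
  assumes D_mult: "derivation_of scale mult D" and D_br: "derivation_of scale br D"
begin

abbreviation "T \<equiv> untwisted.tri (untwisted.conjugate \<alpha> D)"

lemma derivation_linear: "D (x + y) = D x + D y" "D (scale c x) = scale c (D x)"
  using D_mult by (simp_all add: derivation_of_def Vector_Spaces.linear_iff)

text \<open>The powers of \<open>\<alpha>\<close> and \<open>\<beta>\<close> in the definition are those for which the twists add up to the
  same pair of arguments in all three summands.\<close>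

lemma derivation_tri_eq: "derivation_tri D x y z = T (\<alpha> x) (\<alpha> y) (\<beta> z)"
  by (simp add: derivation_tri_def untwisted.tri_def untwisted.conjugate_def untwisted_mult_def untwisted_br_def
      twist_simps)

lemma D_untwisted_mult:
  "D (untwisted_mult x y) = untwisted_mult (untwisted.conjugate \<alpha> D x) y
     + untwisted_mult x (untwisted.conjugate \<beta> D y)"
  using D_mult by (simp add: derivation_of_def untwisted_mult_def untwisted.conjugate_def)

lemma D_untwisted_br:
  "D (untwisted_br x y) = untwisted_br (untwisted.conjugate \<alpha> D x) y
     + untwisted_br x (untwisted.conjugate \<beta> D y)"
  using D_br by (simp add: derivation_of_def untwisted_br_def untwisted.conjugate_def)

lemmas D_facts = automorphism_alpha automorphism_beta alpha_beta_commute derivation_linear(1)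
  D_untwisted_mult D_untwisted_br

lemmas T_alpha = untwisted.tri_invariant(1)[OF D_facts]
lemmas T_beta = untwisted.tri_invariant(2)[OF D_facts]
lemmas T_fundamental = untwisted.tri_fundamental_identity_conjugate[OF D_facts]

lemma T_skew12: "T y x z = - T x y z"
  using untwisted.br_skew[of z x] untwisted.br_skew[of y z] untwisted.br_skew[of y x]
  by (simp add: untwisted.tri_def untwisted.mult_minus_right)

lemma T_skew23: "T x z y = - T x y z"
  using untwisted.br_skew[of z x] untwisted.br_skew[of z y] untwisted.br_skew[of y x]
  by (simp add: untwisted.tri_def untwisted.mult_minus_right)

lemma T_cyclic: "T y z x = T x y z"
  by (simp only: untwisted.tri_def ac_simps)

lemma T_fundamental_cyclic: "T u v (T x y z) = T y z (T u v x) - T x z (T u v y) + T x y (T u v z)"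
  using T_fundamental[of u v x y z] T_cyclic[of y z "T u v x"] T_skew23[of x z "T u v y"] by simp

lemma derivation_tri_three_bihom_lie: "three_bihom_lie_algebra scale (derivation_tri D) \<alpha> \<beta>"
proof
  show "trilinear_op scale (derivation_tri D)"
    unfolding trilinear_op_def Vector_Spaces.linear_iff
    using vector_space_axioms
    by (simp add: derivation_tri_def linear_op linear_inv derivation_linear scale_right_distrib ac_simps)
  fix x y z u v
  show "\<alpha> (derivation_tri D x y z) = derivation_tri D (\<alpha> x) (\<alpha> y) (\<alpha> z)"
    by (simp add: derivation_tri_eq T_alpha beta_alpha)
  show "\<beta> (derivation_tri D x y z) = derivation_tri D (\<beta> x) (\<beta> y) (\<beta> z)"
    by (simp add: derivation_tri_eq T_beta beta_alpha)
  show "derivation_tri D (\<beta> x) (\<beta> y) (\<alpha> z) = - derivation_tri D (\<beta> y) (\<beta> x) (\<alpha> z)"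
    by (simp add: derivation_tri_eq beta_alpha T_skew12[of "\<alpha> (\<beta> y)"])
  show "derivation_tri D (\<beta> x) (\<beta> y) (\<alpha> z) = - derivation_tri D (\<beta> x) (\<beta> z) (\<alpha> y)"
    by (simp add: derivation_tri_eq beta_alpha T_skew23[of _ "\<alpha> (\<beta> z)"])
  show "derivation_tri D (\<beta> (\<beta> u)) (\<beta> (\<beta> v)) (derivation_tri D (\<beta> x) (\<beta> y) (\<alpha> z)) =
         derivation_tri D (\<beta> (\<beta> y)) (\<beta> (\<beta> z)) (derivation_tri D (\<beta> u) (\<beta> v) (\<alpha> x))
         - derivation_tri D (\<beta> (\<beta> x)) (\<beta> (\<beta> z)) (derivation_tri D (\<beta> u) (\<beta> v) (\<alpha> y))
         + derivation_tri D (\<beta> (\<beta> x)) (\<beta> (\<beta> y)) (derivation_tri D (\<beta> u) (\<beta> v) (\<alpha> z))"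
    unfolding derivation_tri_eq T_beta beta_alpha by (rule T_fundamental_cyclic)
qed

end

end

theorem theorem3p4:
  fixes scale :: "'k::field_char_0 \<Rightarrow> 'a::ab_group_add \<Rightarrow> 'a"
    and mult :: "'a \<Rightarrow> 'a \<Rightarrow> 'a" (infixl "\<cdot>" 70)
    and br :: "'a \<Rightarrow> 'a \<Rightarrow> 'a"
    and \<alpha> \<beta> D :: "'a \<Rightarrow> 'a"
  assumes "regular_transposed_bihom_poisson_algebra scale (\<cdot>) br \<alpha> \<beta>"
    and "derivation_of scale (\<cdot>) D"
    and "derivation_of scale br D"
  shows "three_bihom_lie_algebra scale
           (\<lambda>x y z. D x \<cdot> br (inv \<beta> y) (inv \<beta> z)
              + D y \<cdot> br (inv \<alpha> z) (\<alpha> (inv \<beta> (inv \<beta> x)))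
              + D (inv \<alpha> (\<beta> z)) \<cdot> br (inv \<beta> x) (\<alpha> (inv \<beta> (inv \<beta> y))))
           \<alpha> \<beta>"
proof -
  interpret regular_transposed_bihom_poisson_algebra scale mult br \<alpha> \<beta>
    by (rule assms(1))
  show ?thesis
    using derivation_tri_three_bihom_lie[OF assms(2,3)]
    unfolding derivation_tri_def[abs_def] .
qed

end
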